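(* Let $(M,g)=(B\times_f F,\ g_B\oplus f^2 g_F)$ be a warped product of two Riemannian manifolds $(B,g_B)$ and $(F,g_F)$ with warping function $f$, $\dim B=m$ and $\dim F=n$. Let $(M,g,\mu,\xi)$ be a conformal Ricci soliton and suppose $\xi_B$ and $\xi_F$ are conformal on the base $B$ and the fiber $F$ with factors $2\rho_B$ and $2\rho_F$ respectively, where $\rho_B$ and $\rho_F$ are two smooth functions (on $B$ and $F$ respectively). Then the manifold $(M,g)$ is Einstein provided $\rho_B=\rho_F+\xi_B(\ln f)$.
   Context: Warped product: for Riemannian manifolds $(B,g_B)$ (base) and $(F,g_F)$ (fiber) and a positive smooth function $f$ on $B$ (warping function), $M=B\times_f F$ is the product manifold $B\times F$ with metric $g=\pi^*g_B+(f\circ\pi)^2\sigma^*g_F$, where $\pi,\sigma$ are the projections onto $B$ and $F$; this metric is also written $g_B\oplus f^2g_F$. Functions on $B$ and $F$ are identified with their lifts to $M$. Conformal Ricci soliton: $(M,g,\mu,\xi)$ is a conformal Ricci soliton if $\mathcal{L}_\xi g+2\,Ric=\mu g$, where $\xi$ is a smooth vector field on $M$ and $\mu=2\lambda-(p+\frac2n)$, with $\lambda$ a real constant (soliton constant) and $p$ a scalar field (conformal pressure). Vector field convention: $\xi=\xi_B+\xi_F$, where $\xi_B$ and $\xi_F$ are (lifts to $M$ of) vector fields on $B$ and on $F$ respectively. A vector field $X$ on a Riemannian manifold $(N,h)$ is conformal with factor $\sigma$ ($\sigma$ a smooth function on $N$) if $\mathcal{L}_X h=\sigma h$. Einstein manifold: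 $Ric=\beta g$ for some scalar factor $\beta$; in the paper's usage $\beta$ may be a smooth function. *)

theory Defs
  imports "HOL-Analysis.Analysis"
begin

section \<open>Smooth functions on open subsets of normed spaces\<close>

text \<open>All sets on which these are used are open, so derivatives are taken unrestricted.\<close>

primrec Ck_on :: "nat \<Rightarrow> 'a::real_normed_vector set \<Rightarrow> ('a \<Rightarrow> 'b::real_normed_vector) \<Rightarrow> bool" where
  "Ck_on 0 S f \<longleftrightarrow> continuous_on S f"
| "Ck_on (Suc k) S f \<longleftrightarrow>
     (\<forall>x\<in>S. f differentiable (at x)) \<and> (\<forall>v. Ck_on k S (\<lambda>x. frechet_derivative f (at x) v))"

definition smooth_on :: "'a::real_normed_vector set \<Rightarrow> ('a \<Rightarrow> 'b::real_normed_vector) \<Rightarrow> bool" where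
  "smooth_on S f \<longleftrightarrow> (\<forall>k. Ck_on k S f)"


section \<open>Manifolds given by an indexed atlas\<close>

text \<open>A manifold is a topological space with an indexed family of charts
  \<open>coord M i : cdom M i \<rightarrow> 'e\<close>, \<open>i \<in> charts M\<close>. Its dimension is \<open>DIM('e)\<close>.
  The values of \<open>cdom M\<close> and \<open>coord M\<close> outside \<open>charts M\<close> play no role.\<close>

record ('a, 'i, 'e) atlas =
  mtop :: "'a topology"
  charts :: "'i set"
  cdom :: "'i \<Rightarrow> 'a set"
  coord :: "'i \<Rightarrow> 'a \<Rightarrow> 'e"

definition param :: "('a, 'i, 'e) atlas \<Rightarrow> 'i \<Rightarrow> 'e \<Rightarrow> 'a" where
  "param M i = inv_into (cdom M i) (coord M i)"

definition smooth_manifold :: "('a, 'i, 'e::euclidean_space) atlas \<Rightarrow> bool" where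
  "smooth_manifold M \<longleftrightarrow>
     Hausdorff_space (mtop M) \<and> second_countable (mtop M) \<and>
     (\<Union>i\<in>charts M. cdom M i) = topspace (mtop M) \<and>
     (\<forall>i\<in>charts M.
        openin (mtop M) (cdom M i) \<and> open (coord M i ` cdom M i) \<and>
        homeomorphic_map (subtopology (mtop M) (cdom M i))
          (top_of_set (coord M i ` cdom M i)) (coord M i)) \<and>
     (\<forall>i\<in>charts M. \<forall>j\<in>charts M.
        smooth_on (coord M i ` (cdom M i \<inter> cdom M j)) (coord M j \<circ> param M i))"

definition smooth_fun :: "('a, 'i, 'e::euclidean_space) atlas \<Rightarrow> ('a \<Rightarrow> real) \<Rightarrow> bool" where
  "smooth_fun M h \<longleftrightarrow> (\<forall>i\<in>charts M. smooth_on (coord M i ` cdom M i) (h \<circ> param M i))"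

definition transition_deriv ::
  "('a, 'i, 'e::euclidean_space) atlas \<Rightarrow> 'i \<Rightarrow> 'i \<Rightarrow> 'a \<Rightarrow> 'e \<Rightarrow> 'e" where
  "transition_deriv M i j x = frechet_derivative (coord M j \<circ> param M i) (at (coord M i x))"


section \<open>Vector fields and covariant 2-tensor fields\<close>

text \<open>A tangent vector at a point \<open>x\<close> is given by its components with respect to all charts
  around \<open>x\<close>, subject to the transformation law. Thus \<open>X i x\<close> is the component, in the chart
  \<open>i\<close>, of the vector field \<open>X\<close> at the point \<open>x\<close>, and \<open>T i x v w\<close> is the value of the tensor field
  \<open>T\<close> at \<open>x\<close> on the two tangent vectors whose components in the chart \<open>i\<close> are \<open>v\<close> and \<open>w\<close>.
  Only the values with \<open>i \<in> charts M\<close> and \<open>x \<in> cdom M i\<close> matter.\<close>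

type_synonym ('a, 'i, 'e) vfield = "'i \<Rightarrow> 'a \<Rightarrow> 'e"
type_synonym ('a, 'i, 'e) tensor2 = "'i \<Rightarrow> 'a \<Rightarrow> 'e \<Rightarrow> 'e \<Rightarrow> real"

definition vector_field ::
  "('a, 'i, 'e::euclidean_space) atlas \<Rightarrow> ('a, 'i, 'e) vfield \<Rightarrow> bool" where
  "vector_field M X \<longleftrightarrow>
     (\<forall>i\<in>charts M. smooth_on (coord M i ` cdom M i) (X i \<circ> param M i)) \<and>
     (\<forall>i\<in>charts M. \<forall>j\<in>charts M. \<forall>x\<in>cdom M i \<inter> cdom M j.
        X j x = transition_deriv M i j x (X i x))"

definition riemannian_metric ::
  "('a, 'i, 'e::euclidean_space) atlas \<Rightarrow> ('a, 'i, 'e) tensor2 \<Rightarrow> bool" where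
  "riemannian_metric M g \<longleftrightarrow>
     (\<forall>i\<in>charts M. \<forall>v w. smooth_on (coord M i ` cdom M i) (\<lambda>y. g i (param M i y) v w)) \<and>
     (\<forall>i\<in>charts M. \<forall>x\<in>cdom M i.
        bilinear (g i x) \<and> (\<forall>v w. g i x v w = g i x w v) \<and> (\<forall>v. v \<noteq> 0 \<longrightarrow> g i x v v > 0)) \<and>
     (\<forall>i\<in>charts M. \<forall>j\<in>charts M. \<forall>x\<in>cdom M i \<inter> cdom M j. \<forall>v w.
        g i x v w = g j x (transition_deriv M i j x v) (transition_deriv M i j x w))"

definition riemannian_manifold ::
  "('a, 'i, 'e::euclidean_space) atlas \<Rightarrow> ('a, 'i, 'e) tensor2 \<Rightarrow> bool" where
  "riemannian_manifold M g \<longleftrightarrow> smooth_manifold M \<and> riemannian_metric M g"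

text \<open>The derivative \<open>X(h)\<close> of a function along a vector field. It is computed in some chart
  around the point; by the transformation law of \<open>X\<close> the choice is immaterial.\<close>

definition vf_apply ::
  "('a, 'i, 'e::euclidean_space) atlas \<Rightarrow> ('a, 'i, 'e) vfield \<Rightarrow> ('a \<Rightarrow> real) \<Rightarrow> 'a \<Rightarrow> real" where
  "vf_apply M X h x =
     (let i = (SOME i. i \<in> charts M \<and> x \<in> cdom M i)
      in frechet_derivative (h \<circ> param M i) (at (coord M i x)) (X i x))"

text \<open>The Lie derivative \<open>(L_X T)(v, w) = X(T(v, w)) - T([X, v], w) - T(v, [X, w])\<close>, evaluated on
  vector fields \<open>v\<close>, \<open>w\<close> with constant components in the chart, for which \<open>[X, v] = - DX v\<close>.\<close>

definition lie_derivative ::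
  "('a, 'i, 'e::euclidean_space) atlas \<Rightarrow> ('a, 'i, 'e) vfield \<Rightarrow> ('a, 'i, 'e) tensor2
     \<Rightarrow> ('a, 'i, 'e) tensor2" where
  "lie_derivative M X T i x v w =
     (let y = coord M i x; DX = frechet_derivative (X i \<circ> param M i) (at y)
      in frechet_derivative (\<lambda>z. T i (param M i z) v w) (at y) (X i x)
         + T i x (DX v) w + T i x v (DX w))"


section \<open>Levi-Civita connection and Ricci tensor\<close>

text \<open>Here \<open>h\<close> is a metric on an open subset of \<open>'e\<close>. For fields \<open>u\<close>, \<open>v\<close> with constant
  components, \<open>christoffel h x u v\<close> is the covariant derivative of \<open>v\<close> along \<open>u\<close> at \<open>x\<close>,
  characterised by the Koszul formula (all brackets of constant fields vanish).\<close>

definition christoffel ::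
  "('e::euclidean_space \<Rightarrow> 'e \<Rightarrow> 'e \<Rightarrow> real) \<Rightarrow> 'e \<Rightarrow> 'e \<Rightarrow> 'e \<Rightarrow> 'e" where
  "christoffel h x u v =
     (THE z. \<forall>w. 2 * h x z w =
        frechet_derivative (\<lambda>y. h y v w) (at x) u
      + frechet_derivative (\<lambda>y. h y u w) (at x) v
      - frechet_derivative (\<lambda>y. h y u v) (at x) w)"

text \<open>\<open>R(u, v) w\<close>, with \<open>R(u, v)\<close> the commutator of the covariant derivatives along \<open>u\<close> and \<open>v\<close>.\<close>

definition curvature ::
  "('e::euclidean_space \<Rightarrow> 'e \<Rightarrow> 'e \<Rightarrow> real) \<Rightarrow> 'e \<Rightarrow> 'e \<Rightarrow> 'e \<Rightarrow> 'e \<Rightarrow> 'e" where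
  "curvature h x u v w =
     frechet_derivative (\<lambda>y. christoffel h y v w) (at x) u
   - frechet_derivative (\<lambda>y. christoffel h y u w) (at x) v
   + christoffel h x u (christoffel h x v w)
   - christoffel h x v (christoffel h x u w)"

text \<open>\<open>Ric(v, w)\<close> is the trace of \<open>u \<mapsto> R(u, v) w\<close>; with this sign round spheres have
  positive Ricci curvature.\<close>

definition ricci ::
  "('a, 'i, 'e::euclidean_space) atlas \<Rightarrow> ('a, 'i, 'e) tensor2 \<Rightarrow> ('a, 'i, 'e) tensor2" where
  "ricci M g i x v w =
     (\<Sum>b\<in>Basis. curvature (\<lambda>y. g i (param M i y)) (coord M i x) b v w \<bullet> b)"


section \<open>Conformal fields, conformal Ricci solitons, Einstein metrics\<close>

definition conformal_field ::
  "('a, 'i, 'e::euclidean_space) atlas \<Rightarrow> ('a, 'i, 'e) tensor2 \<Rightarrow> ('a, 'i, 'e) vfield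
     \<Rightarrow> ('a \<Rightarrow> real) \<Rightarrow> bool" where
  "conformal_field M g X s \<longleftrightarrow>
     vector_field M X \<and> smooth_fun M s \<and>
     (\<forall>i\<in>charts M. \<forall>x\<in>cdom M i. \<forall>v w. lie_derivative M X g i x v w = s x * g i x v w)"

text \<open>Here \<open>l\<close> is the soliton constant and \<open>p\<close> the conformal pressure; \<open>DIM('e)\<close> is the
  dimension of the manifold \<open>M\<close> carrying the soliton.\<close>

definition conformal_ricci_soliton ::
  "('a, 'i, 'e::euclidean_space) atlas \<Rightarrow> ('a, 'i, 'e) tensor2 \<Rightarrow> ('a \<Rightarrow> real)
     \<Rightarrow> ('a, 'i, 'e) vfield \<Rightarrow> bool" where
  "conformal_ricci_soliton M g mu X \<longleftrightarrow>
     vector_field M X \<and>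
     (\<exists>(l::real) p. smooth_fun M p \<and>
        (\<forall>x\<in>topspace (mtop M). mu x = 2 * l - (p x + 2 / real DIM('e)))) \<and>
     (\<forall>i\<in>charts M. \<forall>x\<in>cdom M i. \<forall>v w.
        lie_derivative M X g i x v w + 2 * ricci M g i x v w = mu x * g i x v w)"

definition einstein ::
  "('a, 'i, 'e::euclidean_space) atlas \<Rightarrow> ('a, 'i, 'e) tensor2 \<Rightarrow> bool" where
  "einstein M g \<longleftrightarrow>
     (\<exists>b. smooth_fun M b \<and>
        (\<forall>i\<in>charts M. \<forall>x\<in>cdom M i. \<forall>v w. ricci M g i x v w = b x * g i x v w))"


section \<open>Warped products\<close>

definition prod_manifold ::
  "('a, 'i, 'e) atlas \<Rightarrow> ('b, 'j, 'k) atlas \<Rightarrow> ('a \<times> 'b, 'i \<times> 'j, 'e \<times> 'k) atlas" where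
  "prod_manifold B F =
     \<lparr> mtop = prod_topology (mtop B) (mtop F),
       charts = charts B \<times> charts F,
       cdom = (\<lambda>(i, j). cdom B i \<times> cdom F j),
       coord = (\<lambda>(i, j). map_prod (coord B i) (coord F j)) \<rparr>"

text \<open>In product charts the projections of the product onto \<open>B\<close> and \<open>F\<close> have derivatives
  \<open>fst\<close> and \<open>snd\<close>.\<close>

definition warped_metric ::
  "('a, 'i, 'e) tensor2 \<Rightarrow> ('a \<Rightarrow> real) \<Rightarrow> ('b, 'j, 'k) tensor2
     \<Rightarrow> ('a \<times> 'b, 'i \<times> 'j, 'e \<times> 'k) tensor2" where
  "warped_metric gB f gF = (\<lambda>(i, j) (x, y) v w.
     gB i x (fst v) (fst w) + (f x)\<^sup>2 * gF j y (snd v) (snd w))"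

definition lift_base ::
  "('a, 'i, 'e) vfield \<Rightarrow> ('a \<times> 'b, 'i \<times> 'j, 'e \<times> 'k::zero) vfield" where
  "lift_base X = (\<lambda>(i, j) (x, y). (X i x, 0))"

definition lift_fiber ::
  "('b, 'j, 'k) vfield \<Rightarrow> ('a \<times> 'b, 'i \<times> 'j, 'e::zero \<times> 'k) vfield" where
  "lift_fiber Y = (\<lambda>(i, j) (x, y). (0, Y j y))"

end

theory Submission
  imports Defs
begin

text \<open>Only the Lie derivative of the warped metric has to be computed; the Ricci tensor enters
  through the soliton equation and is never unfolded. In a product chart the metric is
  \<open>gB + f\<^sup>2 gF\<close> and \<open>\<xi>\<close> is the pair \<open>(\<xi>B, \<xi>F)\<close>, so the product rule gives
  \<open>L_\<xi> g = L_\<xi>B gB + f\<^sup>2 L_\<xi>F gF + 2 f \<xi>B(f) gF\<close>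
  (lemma \<open>lie_derivative_warped_metric\<close>). For conformal \<open>\<xi>B\<close> and \<open>\<xi>F\<close>, and since
  \<open>\<xi>B(f) = f \<xi>B(ln f)\<close>, the right side is
  \<open>2 \<rho>B gB + 2 (\<rho>F + \<xi>B(ln f)) f\<^sup>2 gF\<close>. The condition on the factors says precisely that the two
  coefficients agree, so that \<open>L_\<xi> g = 2 \<rho>B g\<close>, and the soliton equation becomes
  \<open>Ric = (\<mu> / 2 - \<rho>B) g\<close>.

  Two points need care beyond this computation. The derivative \<open>\<xi>B(ln f)\<close> is
  taken in an arbitrarily chosen chart, so it has to be carried over to the chart at hand by the
  transformation law (lemma \<open>vf_apply_eq_chart\<close>). And the Einstein factor has to be smooth on
  the product; as \<open>\<mu>\<close> itself is constrained only at points of the manifold, the factor is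
  written in terms of the pressure and the lift of \<open>\<rho>B\<close>.\<close>

section \<open>Calculus on open sets\<close>

lemma frechet_derivative_cong_open:
  assumes "open S" "x \<in> S" "\<And>y. y \<in> S \<Longrightarrow> f y = g y"
  shows "frechet_derivative f (at x) = frechet_derivative g (at x)"
proof -
  have "(f has_derivative D) (at x) \<longleftrightarrow> (g has_derivative D) (at x)" for D
    using has_derivative_transform_within_open[of f D x UNIV S g]
      has_derivative_transform_within_open[of g D x UNIV S f] assms by auto
  then show ?thesis by (simp add: frechet_derivative_def)
qed

lemma differentiable_cong_open:
  assumes "open S" "x \<in> S" "\<And>y. y \<in> S \<Longrightarrow> f y = g y" "f differentiable (at x)"
  shows "g differentiable (at x)"
  using assms has_derivative_transform_within_open[of f _ x UNIV S g]
  unfolding differentiable_def by blast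

lemma smooth_on_imp_differentiable:
  assumes "smooth_on S f" "x \<in> S"
  shows "f differentiable (at x)"
  using assms Ck_on.simps(2)[of 0 S f] unfolding smooth_on_def by blast

lemma smooth_on_imp_has_derivative:
  assumes "smooth_on S f" "x \<in> S"
  shows "(f has_derivative frechet_derivative f (at x)) (at x)"
  using smooth_on_imp_differentiable[OF assms] by (simp add: frechet_derivative_works)

lemma Ck_on_cong:
  assumes "open S" "\<And>x. x \<in> S \<Longrightarrow> f x = g x" "Ck_on k S f"
  shows "Ck_on k S g"
  using assms(2,3)
proof (induction k arbitrary: f g)
  case 0
  then show ?case using continuous_on_cong[of S S f g] by simp
next
  case (Suc k)
  have "Ck_on k S (\<lambda>x. frechet_derivative g (at x) v)" for v
    using Suc.IH[of "\<lambda>x. frechet_derivative f (at x) v"]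
      frechet_derivative_cong_open[OF \<open>open S\<close>, of _ f g] Suc.prems by auto
  moreover have "g differentiable (at x)" if "x \<in> S" for x
    using differentiable_cong_open[OF \<open>open S\<close> that Suc.prems(1)] Suc.prems(2) that by auto
  ultimately show ?case by simp
qed

lemma smooth_on_cong:
  assumes "open S" "\<And>x. x \<in> S \<Longrightarrow> f x = g x" "smooth_on S f"
  shows "smooth_on S g"
  using assms Ck_on_cong[of S f g] unfolding smooth_on_def by blast

lemma Ck_on_const: "Ck_on k S (\<lambda>x. c)"
  by (induction k arbitrary: c) simp_all

lemma Ck_on_add:
  assumes "open S" "Ck_on k S f" "Ck_on k S g"
  shows "Ck_on k S (\<lambda>x. f x + g x)"
  using assms(2,3)
proof (induction k arbitrary: f g)
  case 0
  then show ?case by (simp add: continuous_on_add)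
next
  case (Suc k)
  have D: "((\<lambda>x. f x + g x) has_derivative
      (\<lambda>v. frechet_derivative f (at x) v + frechet_derivative g (at x) v)) (at x)"
    if "x \<in> S" for x
    using Suc.prems that by (intro has_derivative_add) (simp_all add: frechet_derivative_works)
  have "Ck_on k S (\<lambda>x. frechet_derivative (\<lambda>x. f x + g x) (at x) v)" for v
    using Ck_on_cong[OF \<open>open S\<close> _ Suc.IH[of "\<lambda>x. frechet_derivative f (at x) v"
          "\<lambda>x. frechet_derivative g (at x) v"]] Suc.prems
    by (simp add: frechet_derivative_at[OF D, symmetric])
  then show ?case using D by (auto intro: differentiableI)
qed

lemma Ck_on_bounded_linear:
  assumes "open S" "bounded_linear A" "Ck_on k S f"
  shows "Ck_on k S (\<lambda>x. A (f x))"
  using assms(3)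
proof (induction k arbitrary: f)
  case 0
  then show ?case using bounded_linear.continuous_on[OF assms(2)] by simp
next
  case (Suc k)
  have D: "((\<lambda>x. A (f x)) has_derivative (\<lambda>v. A (frechet_derivative f (at x) v))) (at x)"
    if "x \<in> S" for x
    by (rule bounded_linear.has_derivative[OF assms(2)])
      (use Suc.prems that in \<open>simp add: frechet_derivative_works\<close>)
  have "Ck_on k S (\<lambda>x. frechet_derivative (\<lambda>x. A (f x)) (at x) v)" for v
    using Ck_on_cong[OF \<open>open S\<close> _ Suc.IH[of "\<lambda>x. frechet_derivative f (at x) v"]] Suc.prems
    by (simp add: frechet_derivative_at[OF D, symmetric])
  then show ?case using D by (auto intro: differentiableI)
qed

lemma has_derivative_comp_fst:
  assumes "(h has_derivative h') (at (fst z))"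
  shows "((\<lambda>z. h (fst z)) has_derivative (\<lambda>v. h' (fst v))) (at z)"
  by (rule has_derivative_compose[OF has_derivative_fst[OF has_derivative_ident] assms])

lemma has_derivative_comp_snd:
  assumes "(h has_derivative h') (at (snd z))"
  shows "((\<lambda>z. h (snd z)) has_derivative (\<lambda>v. h' (snd v))) (at z)"
  by (rule has_derivative_compose[OF has_derivative_snd[OF has_derivative_ident] assms])

lemma Ck_on_comp_fst:
  assumes "open S" "open T" "Ck_on k S f"
  shows "Ck_on k (S \<times> T) (\<lambda>z. f (fst z))"
  using assms(3)
proof (induction k arbitrary: f)
  case 0
  have "continuous_on (S \<times> T) (f \<circ> fst)"
    using 0 by (intro continuous_on_compose)
      (auto intro: continuous_on_fst continuous_on_subset)
  then show ?case by (simp add: o_def)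
next
  case (Suc k)
  have D: "((\<lambda>z. f (fst z)) has_derivative (\<lambda>v. frechet_derivative f (at (fst z)) (fst v))) (at z)"
    if "z \<in> S \<times> T" for z
    by (rule has_derivative_comp_fst) (use Suc.prems that in \<open>auto simp: frechet_derivative_works\<close>)
  have "Ck_on k (S \<times> T) (\<lambda>z. frechet_derivative (\<lambda>z. f (fst z)) (at z) v)" for v
    using Ck_on_cong[OF open_Times[OF assms(1,2)] _
        Suc.IH[of "\<lambda>x. frechet_derivative f (at x) (fst v)"]] Suc.prems
    by (simp add: frechet_derivative_at[OF D, symmetric])
  then show ?case using differentiableI[OF D] by simp
qed

section \<open>Charts and derivatives along vector fields\<close>

lemma chart_inj_on:
  assumes "smooth_manifold M" "i \<in> charts M"
  shows "inj_on (coord M i) (cdom M i)"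
proof -
  have "topspace (subtopology (mtop M) (cdom M i)) = cdom M i"
    using assms openin_subset[of "mtop M" "cdom M i"] unfolding smooth_manifold_def by auto
  then show ?thesis
    using assms homeomorphic_imp_injective_map unfolding smooth_manifold_def by metis
qed

lemma param_coord:
  assumes "smooth_manifold M" "i \<in> charts M" "x \<in> cdom M i"
  shows "param M i (coord M i x) = x"
  using chart_inj_on[OF assms(1,2)] assms(3) by (simp add: param_def)

lemma open_coord_image:
  assumes "smooth_manifold M" "i \<in> charts M"
  shows "open (coord M i ` cdom M i)"
  using assms unfolding smooth_manifold_def by blast

lemma open_coord_overlap:
  assumes "smooth_manifold M" "i \<in> charts M" "j \<in> charts M"
  shows "open (coord M i ` (cdom M i \<inter> cdom M j))"
proof -
  have "openin (subtopology (mtop M) (cdom M i)) (cdom M i \<inter> cdom M j)"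
    using assms unfolding smooth_manifold_def by (auto intro: openin_subtopology_Int2)
  moreover have "open_map (subtopology (mtop M) (cdom M i))
      (top_of_set (coord M i ` cdom M i)) (coord M i)"
    using assms homeomorphic_imp_open_map unfolding smooth_manifold_def by blast
  ultimately have "openin (top_of_set (coord M i ` cdom M i)) (coord M i ` (cdom M i \<inter> cdom M j))"
    unfolding open_map_def by blast
  then show ?thesis using openin_open_trans open_coord_image[OF assms(1,2)] by blast
qed

text \<open>On the overlap of two charts the coordinate expressions of \<open>h\<close> differ by the transition
  map, whose derivative is also what relates the components of \<open>X\<close>; the chain rule cancels the
  two.\<close>

lemma vf_apply_eq_chart:
  assumes M: "smooth_manifold M" and X: "vector_field M X"
    and i: "i \<in> charts M" "x \<in> cdom M i"
    and h: "\<And>k. k \<in> charts M \<Longrightarrow> x \<in> cdom M k \<Longrightarrow>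
      (h \<circ> param M k) differentiable (at (coord M k x))"
  shows "vf_apply M X h x = frechet_derivative (h \<circ> param M i) (at (coord M i x)) (X i x)"
proof -
  define k where "k = (SOME i. i \<in> charts M \<and> x \<in> cdom M i)"
  have k: "k \<in> charts M" "x \<in> cdom M k"
    using someI[of "\<lambda>i. i \<in> charts M \<and> x \<in> cdom M i" i] i unfolding k_def by auto
  let ?S = "coord M i ` (cdom M i \<inter> cdom M k)"
  let ?t = "coord M k \<circ> param M i"
  have "smooth_on ?S ?t" using M i k unfolding smooth_manifold_def by blast
  then have t: "(?t has_derivative transition_deriv M i k x) (at (coord M i x))"
    unfolding transition_deriv_def by (rule smooth_on_imp_has_derivative) (use i k in auto)
  have tx: "?t (coord M i x) = coord M k x" using param_coord[OF M i] by simp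
  have "((h \<circ> param M k) \<circ> ?t has_derivative
      frechet_derivative (h \<circ> param M k) (at (coord M k x)) \<circ> transition_deriv M i k x)
      (at (coord M i x))"
    by (rule diff_chain_at[OF t]) (use h[OF k] tx in \<open>simp add: frechet_derivative_works\<close>)
  moreover have "frechet_derivative (h \<circ> param M i) (at (coord M i x))
      = frechet_derivative ((h \<circ> param M k) \<circ> ?t) (at (coord M i x))"
    by (rule frechet_derivative_cong_open[OF open_coord_overlap[OF M i(1) k(1)]])
      (use i k param_coord[OF M] in auto)
  ultimately have "frechet_derivative (h \<circ> param M i) (at (coord M i x)) (X i x)
      = frechet_derivative (h \<circ> param M k) (at (coord M k x)) (transition_deriv M i k x (X i x))"
    using frechet_derivative_at by (metis comp_apply)
  moreover have "X k x = transition_deriv M i k x (X i x)"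
    using X i k unfolding vector_field_def by blast
  ultimately show ?thesis by (simp add: vf_apply_def Let_def k_def)
qed

text \<open>The chain rule for \<open>ln\<close>, in a form that turns the warping term of the product rule, computed
  in a given chart, into the chart-independent \<open>X(ln f)\<close> that is compared with the conformal
  factors.\<close>

lemma vf_apply_ln:
  assumes M: "smooth_manifold M" and X: "vector_field M X" and f: "smooth_fun M f"
    and i: "i \<in> charts M" "x \<in> cdom M i" and pos: "f x > 0"
  shows "frechet_derivative (f \<circ> param M i) (at (coord M i x)) (X i x)
    = f x * vf_apply M X (\<lambda>x. ln (f x)) x"
proof -
  have D: "((\<lambda>x. ln (f x)) \<circ> param M k has_derivative
      (\<lambda>v. frechet_derivative (f \<circ> param M k) (at (coord M k x)) v * inverse (f x)))
      (at (coord M k x))"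
    if k: "k \<in> charts M" "x \<in> cdom M k" for k
  proof -
    have "(f \<circ> param M k has_derivative frechet_derivative (f \<circ> param M k) (at (coord M k x)))
        (at (coord M k x))"
      by (rule smooth_on_imp_has_derivative) (use f k in \<open>auto simp: smooth_fun_def\<close>)
    from has_derivative_ln[OF _ this] show ?thesis
      using pos param_coord[OF M k] by (simp add: o_def)
  qed
  have "vf_apply M X (\<lambda>x. ln (f x)) x
      = frechet_derivative ((\<lambda>x. ln (f x)) \<circ> param M i) (at (coord M i x)) (X i x)"
    by (rule vf_apply_eq_chart[OF M X i]) (use D in \<open>auto intro: differentiableI\<close>)
  also have "\<dots> = frechet_derivative (f \<circ> param M i) (at (coord M i x)) (X i x) * inverse (f x)"
    by (simp add: frechet_derivative_at[OF D[OF i], symmetric])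
  finally show ?thesis using pos by simp
qed

section \<open>Warped products\<close>

lemma prod_manifold_simps [simp]:
  "mtop (prod_manifold B F) = prod_topology (mtop B) (mtop F)"
  "charts (prod_manifold B F) = charts B \<times> charts F"
  "cdom (prod_manifold B F) (i, j) = cdom B i \<times> cdom F j"
  "coord (prod_manifold B F) (i, j) = map_prod (coord B i) (coord F j)"
  by (simp_all add: prod_manifold_def)

text \<open>Outside the chart image both sides are unspecified values of the choice operator, so the
  agreement is claimed only on the chart image; that set is open, which is enough for derivatives.\<close>

lemma param_prod_manifold:
  assumes "smooth_manifold B" "smooth_manifold F" "i \<in> charts B" "j \<in> charts F"
    and "z \<in> coord B i ` cdom B i \<times> coord F j ` cdom F j"
  shows "param (prod_manifold B F) (i, j) z = (param B i (fst z), param F j (snd z))"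
proof -
  obtain x y where xy: "x \<in> cdom B i" "y \<in> cdom F j" "z = (coord B i x, coord F j y)"
    using assms(5) by auto
  have "inj_on (map_prod (coord B i) (coord F j)) (cdom B i \<times> cdom F j)"
    by (intro map_prod_inj_on chart_inj_on assms)
  then have "param (prod_manifold B F) (i, j) (map_prod (coord B i) (coord F j) (x, y)) = (x, y)"
    unfolding param_def prod_manifold_simps using xy by (intro inv_into_f_f) auto
  then show ?thesis using xy param_coord[OF assms(1,3)] param_coord[OF assms(2,4)] by simp
qed

text \<open>The product rule. The last summand comes from differentiating the warping function; the
  components of the base field alone enter it, as \<open>f\<close> does not depend on the fiber.\<close>

lemma lie_derivative_warped_metric:
  assumes B: "smooth_manifold B" and F: "smooth_manifold F"
    and gB: "riemannian_metric B gB" and gF: "riemannian_metric F gF"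
    and f: "smooth_fun B f" and X: "vector_field B X" and Y: "vector_field F Y"
    and i: "i \<in> charts B" "x \<in> cdom B i" and j: "j \<in> charts F" "y \<in> cdom F j"
  shows "lie_derivative (prod_manifold B F) (\<lambda>c z. lift_base X c z + lift_fiber Y c z)
      (warped_metric gB f gF) (i, j) (x, y) v w
    = lie_derivative B X gB i x (fst v) (fst w)
      + (f x)\<^sup>2 * lie_derivative F Y gF j y (snd v) (snd w)
      + 2 * f x * frechet_derivative (f \<circ> param B i) (at (coord B i x)) (X i x)
        * gF j y (snd v) (snd w)"
proof -
  let ?M = "prod_manifold B F" and ?Z = "\<lambda>c z. lift_base X c z + lift_fiber Y c z"
  let ?g = "warped_metric gB f gF"
  let ?a = "coord B i x" and ?b = "coord F j y"
  let ?S = "coord B i ` cdom B i" and ?T = "coord F j ` cdom F j"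
  let ?GB = "\<lambda>a. gB i (param B i a) (fst v) (fst w)"
  let ?GF = "\<lambda>b. gF j (param F j b) (snd v) (snd w)"
  let ?DX = "frechet_derivative (X i \<circ> param B i) (at ?a)"
  let ?DY = "frechet_derivative (Y j \<circ> param F j) (at ?b)"
  let ?Df = "frechet_derivative (f \<circ> param B i) (at ?a)"
  have opn: "open (?S \<times> ?T)" and ab: "(?a, ?b) \<in> ?S \<times> ?T"
    using open_Times[OF open_coord_image[OF B i(1)] open_coord_image[OF F j(1)]] i j by auto
  note param = param_prod_manifold[OF B F i(1) j(1)]
  have a: "?a \<in> ?S" and b: "?b \<in> ?T" using i j by auto
  have px: "param B i ?a = x" and py: "param F j ?b = y"
    using param_coord[OF B i] param_coord[OF F j] by auto
  have dX: "(X i \<circ> param B i has_derivative ?DX) (at ?a)"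
    using X i a by (intro smooth_on_imp_has_derivative) (auto simp: vector_field_def)
  have dY: "(Y j \<circ> param F j has_derivative ?DY) (at ?b)"
    using Y j b by (intro smooth_on_imp_has_derivative) (auto simp: vector_field_def)
  have df: "(f \<circ> param B i has_derivative ?Df) (at ?a)"
    using f i a by (intro smooth_on_imp_has_derivative) (auto simp: smooth_fun_def)
  have dGB: "(?GB has_derivative frechet_derivative ?GB (at ?a)) (at ?a)"
    using gB i a by (intro smooth_on_imp_has_derivative) (auto simp: riemannian_metric_def)
  have dGF: "(?GF has_derivative frechet_derivative ?GF (at ?b)) (at ?b)"
    using gF j b by (intro smooth_on_imp_has_derivative) (auto simp: riemannian_metric_def)

  have "((\<lambda>z. ((X i \<circ> param B i) (fst z), (Y j \<circ> param F j) (snd z))) has_derivative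
      (\<lambda>u. (?DX (fst u), ?DY (snd u)))) (at (?a, ?b))"
    by (intro has_derivative_Pair has_derivative_comp_fst has_derivative_comp_snd)
      (simp_all add: dX dY del: comp_apply)
  moreover have "frechet_derivative (?Z (i, j) \<circ> param ?M (i, j)) (at (?a, ?b))
      = frechet_derivative (\<lambda>z. ((X i \<circ> param B i) (fst z), (Y j \<circ> param F j) (snd z)))
          (at (?a, ?b))"
    by (rule frechet_derivative_cong_open[OF opn ab])
      (simp add: param lift_base_def lift_fiber_def)
  ultimately have DZ: "frechet_derivative (?Z (i, j) \<circ> param ?M (i, j)) (at (?a, ?b)) u
      = (?DX (fst u), ?DY (snd u))" for u
    by (simp add: frechet_derivative_at[symmetric])

  note dGB' = has_derivative_comp_fst[of _ _ "(?a, ?b)", simplified, OF dGB]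
  note dGF' = has_derivative_comp_snd[of _ _ "(?a, ?b)", simplified, OF dGF]
  note df' = has_derivative_comp_fst[of _ _ "(?a, ?b)", simplified, OF df]
  have "((\<lambda>z. ?GB (fst z) + ((f \<circ> param B i) (fst z))\<^sup>2 * ?GF (snd z)) has_derivative
      (\<lambda>u. frechet_derivative ?GB (at ?a) (fst u)
        + ((f x)\<^sup>2 * frechet_derivative ?GF (at ?b) (snd u)
           + 2 * f x * ?Df (fst u) * gF j y (snd v) (snd w)))) (at (?a, ?b))"
    by (rule derivative_eq_intros dGB' dGF' df' refl)+ (simp add: px py ac_simps)
  moreover have "frechet_derivative (\<lambda>z. ?g (i, j) (param ?M (i, j) z) v w) (at (?a, ?b))
      = frechet_derivative (\<lambda>z. ?GB (fst z) + ((f \<circ> param B i) (fst z))\<^sup>2 * ?GF (snd z))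
          (at (?a, ?b))"
    by (rule frechet_derivative_cong_open[OF opn ab]) (simp add: param warped_metric_def)
  ultimately have "frechet_derivative (\<lambda>z. ?g (i, j) (param ?M (i, j) z) v w) (at (?a, ?b)) u
      = frechet_derivative ?GB (at ?a) (fst u)
        + ((f x)\<^sup>2 * frechet_derivative ?GF (at ?b) (snd u)
           + 2 * f x * ?Df (fst u) * gF j y (snd v) (snd w))" for u
    by (simp add: frechet_derivative_at[symmetric])
  then show ?thesis
    by (simp add: lie_derivative_def Let_def DZ)
      (simp add: lift_base_def lift_fiber_def warped_metric_def algebra_simps)
qed

text \<open>The warping function stretches the fiber at the logarithmic rate \<open>X(ln f)\<close>; once this rate
  makes up for the difference of the two conformal factors, base and fiber are scaled alike.\<close>

lemma lie_derivative_warped_metric_conformal: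
  assumes B: "riemannian_manifold B gB" and F: "riemannian_manifold F gF"
    and f: "smooth_fun B f" and pos: "f x > 0"
    and X: "conformal_field B gB X (\<lambda>x. 2 * r x)" and Y: "conformal_field F gF Y (\<lambda>y. 2 * s y)"
    and i: "i \<in> charts B" "x \<in> cdom B i" and j: "j \<in> charts F" "y \<in> cdom F j"
    and eq: "r x = s y + vf_apply B X (\<lambda>x. ln (f x)) x"
  shows "lie_derivative (prod_manifold B F) (\<lambda>c z. lift_base X c z + lift_fiber Y c z)
      (warped_metric gB f gF) (i, j) (x, y) v w
    = 2 * r x * warped_metric gB f gF (i, j) (x, y) v w"
proof -
  have *: "smooth_manifold B" "smooth_manifold F" "riemannian_metric B gB"
      "riemannian_metric F gF" "vector_field B X" "vector_field F Y"
    using B F X Y unfolding riemannian_manifold_def conformal_field_def by auto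
  have LB: "lie_derivative B X gB i x v w = 2 * r x * gB i x v w" for v w
    using X i unfolding conformal_field_def by auto
  have LF: "lie_derivative F Y gF j y v w = 2 * s y * gF j y v w" for v w
    using Y j unfolding conformal_field_def by auto
  have "lie_derivative (prod_manifold B F) (\<lambda>c z. lift_base X c z + lift_fiber Y c z)
      (warped_metric gB f gF) (i, j) (x, y) v w
    = 2 * r x * gB i x (fst v) (fst w) + (f x)\<^sup>2 * (2 * s y * gF j y (snd v) (snd w))
      + 2 * f x * (f x * vf_apply B X (\<lambda>x. ln (f x)) x) * gF j y (snd v) (snd w)"
    unfolding lie_derivative_warped_metric[OF *(1-4) f *(5,6) i j] LB LF
      vf_apply_ln[OF *(1,5) f i pos] ..
  then show ?thesis
    by (simp add: eq warped_metric_def power2_eq_square algebra_simps)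
qed

theorem theorem3p3:
  fixes B :: "('a, 'i, 'e::euclidean_space) atlas"
    and F :: "('b, 'j, 'k::euclidean_space) atlas"
    and gB :: "('a, 'i, 'e) tensor2" and gF :: "('b, 'j, 'k) tensor2"
    and f \<rho>B :: "'a \<Rightarrow> real" and \<rho>F :: "'b \<Rightarrow> real"
    and \<mu> :: "'a \<times> 'b \<Rightarrow> real"
    and \<xi>B :: "('a, 'i, 'e) vfield" and \<xi>F :: "('b, 'j, 'k) vfield"
  defines "M \<equiv> prod_manifold B F" and "g \<equiv> warped_metric gB f gF"
  assumes "riemannian_manifold B gB" and "riemannian_manifold F gF"
    and "smooth_fun B f" and "\<forall>x\<in>topspace (mtop B). f x > 0"
    and "conformal_ricci_soliton M g \<mu> (\<lambda>c z. lift_base \<xi>B c z + lift_fiber \<xi>F c z)"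
    and "smooth_fun B \<rho>B" and "smooth_fun F \<rho>F"
    and "conformal_field B gB \<xi>B (\<lambda>x. 2 * \<rho>B x)"
    and "conformal_field F gF \<xi>F (\<lambda>y. 2 * \<rho>F y)"
    and "\<forall>x\<in>topspace (mtop B). \<forall>y\<in>topspace (mtop F).
           \<rho>B x = \<rho>F y + vf_apply B \<xi>B (\<lambda>x. ln (f x)) x"
  shows "einstein M g"
proof -
  let ?Z = "\<lambda>c z. lift_base \<xi>B c z + lift_fiber \<xi>F c z"
  have B: "smooth_manifold B" and F: "smooth_manifold F"
    using assms(3,4) unfolding riemannian_manifold_def by auto
  obtain l p where p: "smooth_fun M p"
    and mu: "\<And>z. z \<in> topspace (mtop M) \<Longrightarrow> \<mu> z = 2 * l - (p z + 2 / real DIM('e \<times> 'k))"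
    using assms(7) unfolding conformal_ricci_soliton_def by blast
  have soliton: "lie_derivative M ?Z g c z v w + 2 * ricci M g c z v w = \<mu> z * g c z v w"
    if "c \<in> charts M" "z \<in> cdom M c" for c z v w
    using assms(7) that unfolding conformal_ricci_soliton_def by blast

  \<comment> \<open>This is \<open>\<mu> / 2 - \<rho>B\<close> at points of the product, arranged as a sum of a constant and of
    linear images of smooth functions.\<close>
  define b where "b z = (l - 1 / real DIM('e \<times> 'k)) + ((- 1 / 2) * p z + - \<rho>B (fst z))" for z
  have "smooth_fun M b"
    unfolding smooth_fun_def
  proof
    fix c assume "c \<in> charts M"
    then obtain i j where c: "c = (i, j)" "i \<in> charts B" "j \<in> charts F"
      by (auto simp: M_def)
    let ?S = "coord B i ` cdom B i" and ?T = "coord F j ` cdom F j"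
    have im: "coord M c ` cdom M c = ?S \<times> ?T" by (auto simp: M_def c)
    have opn: "open (?S \<times> ?T)"
      by (intro open_Times open_coord_image B F c)
    have "Ck_on k (?S \<times> ?T) (\<lambda>z. (l - 1 / real DIM('e \<times> 'k))
        + ((- 1 / 2) * (p \<circ> param M c) z + - (\<rho>B \<circ> param B i) (fst z)))" for k
    proof (intro Ck_on_add[OF opn] Ck_on_const)
      have "Ck_on k (?S \<times> ?T) (p \<circ> param M c)"
        using p \<open>c \<in> charts M\<close> im unfolding smooth_fun_def smooth_on_def by auto
      then show "Ck_on k (?S \<times> ?T) (\<lambda>z. (- 1 / 2) * (p \<circ> param M c) z)"
        by (rule Ck_on_bounded_linear[OF opn bounded_linear_mult_right])
      have "Ck_on k ?S (\<rho>B \<circ> param B i)"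
        using assms(8) c unfolding smooth_fun_def smooth_on_def by auto
      then have "Ck_on k (?S \<times> ?T) (\<lambda>z. (\<rho>B \<circ> param B i) (fst z))"
        by (intro Ck_on_comp_fst open_coord_image B F c)
      then show "Ck_on k (?S \<times> ?T) (\<lambda>z. - (\<rho>B \<circ> param B i) (fst z))"
        by (rule Ck_on_bounded_linear[OF opn bounded_linear_minus[OF bounded_linear_ident]])
    qed
    then have "smooth_on (?S \<times> ?T) (\<lambda>z. (l - 1 / real DIM('e \<times> 'k))
        + ((- 1 / 2) * (p \<circ> param M c) z + - (\<rho>B \<circ> param B i) (fst z)))"
      unfolding smooth_on_def by blast
    then have "smooth_on (?S \<times> ?T) (b \<circ> param M c)"
      by (rule smooth_on_cong[OF opn, rotated])
        (simp add: b_def M_def c param_prod_manifold[OF B F])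
    then show "smooth_on (coord M c ` cdom M c) (b \<circ> param M c)" unfolding im .
  qed
  moreover have "ricci M g c z v w = b z * g c z v w"
    if cz: "c \<in> charts M" "z \<in> cdom M c" for c z v w
  proof -
    obtain i j x y where c: "c = (i, j)" "i \<in> charts B" "j \<in> charts F"
      and z: "z = (x, y)" "x \<in> cdom B i" "y \<in> cdom F j"
      using cz by (auto simp: M_def)
    have xy: "x \<in> topspace (mtop B)" "y \<in> topspace (mtop F)"
      using B F c z unfolding smooth_manifold_def by blast+
    have "lie_derivative M ?Z g c z v w = 2 * \<rho>B x * g c z v w"
      unfolding M_def g_def c(1) z(1)
      by (rule lie_derivative_warped_metric_conformal[OF assms(3-5) _ assms(10,11)])
        (use c z xy assms(6,12) in auto)
    moreover have "\<mu> z = 2 * b z + 2 * \<rho>B x"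
      using mu[of z] xy by (simp add: b_def M_def z)
    ultimately show ?thesis using soliton[OF cz, of v w] by (simp add: algebra_simps)
  qed
  ultimately show ?thesis unfolding einstein_def by blast
qed

end
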